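(* Let $z\in\{23,32\}$, let $m\ge 1$ be an integer, and let $C=a\,C_a\oplus b\,C_b$ be an $H_z$-code of length $n=2m$, with binary component $C_a\subseteq\mathbb{F}_2^{n}$ and ternary component $C_b\subseteq\mathbb{F}_3^{n}$. Then: (1) if $z=23$, then $C$ is symplectic self-orthogonal if and only if $C_a$ is a binary symplectic self-orthogonal code; (2) if $z=32$, then $C$ is symplectic self-orthogonal if and only if $C_b$ is a ternary symplectic self-orthogonal code.
   Context: Rings: $H_{23}=\langle a,b\mid 2a=0,\ 3b=0,\ a^2=a,\ b^2=0,\ ab=ba=0\rangle$ and $H_{32}=\langle a,b\mid 2a=0,\ 3b=0,\ a^2=0,\ b^2=b,\ ab=ba=0\rangle$ are the commutative non-unital rings of order six with elements $0,a,b,a+b,2b,a+2b$. For $\mathbf{x}\in\mathbb{F}_2^n$, $a\mathbf{x}$ is the vector obtained coordinatewise from $a\cdot0=0$, $a\cdot1=a$; for $\mathbf{y}\in\mathbb{F}_3^n$, $b\mathbf{y}$ is obtained coordinatewise from $b\cdot0=0$, $b\cdot1=b$, $b\cdot2=2b$. Every vector of $H_z^n$ is uniquely $a\mathbf{x}+b\mathbf{y}$ with $\mathbf{x}\in\mathbb{F}_2^n$, $\mathbf{y}\in\mathbb{F}_3^n$. Codes: an $H_z$-code of length $n$ is an $H_z$-submodule $C\subseteq H_z^n$ (an additive subgroup closed under multiplication by elements of $H_z$). It decomposes as $C=aC_a\oplus bC_b=\{a\mathbf{u}+b\mathbf{v}: \mathbf{u}\in C_a,\mathbf{v}\in C_b\}$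 with $C_a=\{\mathbf{u}\in\mathbb{F}_2^n: a\mathbf{u}\in C\}$ and $C_b=\{\mathbf{v}\in\mathbb{F}_3^n: b\mathbf{v}\in C\}$, which are linear codes over $\mathbb{F}_2$ and $\mathbb{F}_3$ respectively. Symplectic forms: for $p\in\{2,3\}$ write $\mathbf{x}=(\mathbf{x}_1\mid\mathbf{x}_2)\in\mathbb{F}_p^{2m}$ with $\mathbf{x}_i\in\mathbb{F}_p^m$. Set $\langle\mathbf{x},\mathbf{y}\rangle_s^{(\mathbb{F}_2)}=\mathbf{x}_1\cdot\mathbf{y}_2+\mathbf{x}_2\cdot\mathbf{y}_1$ and $\langle\mathbf{x},\mathbf{y}\rangle_s^{(\mathbb{F}_3)}=\mathbf{x}_1\cdot\mathbf{y}_2-\mathbf{x}_2\cdot\mathbf{y}_1$, where $\cdot$ is the usual dot product. For vectors $\mathbf{c}_1=a\mathbf{x}_1+b\mathbf{y}_1$, $\mathbf{c}_2=a\mathbf{x}_2+b\mathbf{y}_2$ in $H_z^{2m}$ (here $\mathbf{x}_i\in\mathbb{F}_2^{2m}$, $\mathbf{y}_i\in\mathbb{F}_3^{2m}$), set $\langle\mathbf{c}_1,\mathbf{c}_2\rangle_S=a^2\langle\mathbf{x}_1,\mathbf{x}_2\rangle_s^{(\mathbb{F}_2)}+b^2\langle\mathbf{y}_1,\mathbf{y}_2\rangle_s^{(\mathbb{F}_3)}$; thus it equals $a\langle\mathbf{x}_1,\mathbf{x}_2\rangle_s^{(\mathbb{F}_2)}$ over $H_{23}$ and $b\langle\mathbf{y}_1,\mathbf{y}_2\rangle_s^{(\mathbb{F}_3)}$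 over $H_{32}$. The symplectic dual $C^{\perp_S}$ of a code $C$ (over $\mathbb{F}_2$, $\mathbb{F}_3$ or $H_z$, of length $2m$) is the set of all vectors of the ambient space orthogonal to every element of $C$ under the corresponding symplectic form. $C$ is symplectic self-orthogonal if $C\subseteq C^{\perp_S}$. *)

theory Defs
  imports "HOL-Analysis.Finite_Cartesian_Product" "HOL-Library.Numeral_Type"
begin

text \<open>
  The fields with two and three elements are the library types \<open>2\<close> and \<open>3\<close>, the integers modulo 2
  and modulo 3. The library provides them as commutative rings; the following facts show that they
  are fields with the expected elements.
\<close>

lemma F2_cases: "x = 0 \<or> x = 1" for x :: 2
proof -
  obtain z where "x = of_int z" "0 \<le> z" "z < 2"
    by (cases x) auto
  moreover from this have "z = 0 \<or> z = 1" by linarith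
  ultimately show ?thesis by auto
qed

lemma F3_cases: "x = 0 \<or> x = 1 \<or> x = 2" for x :: 3
proof -
  obtain z where "x = of_int z" "0 \<le> z" "z < 3"
    by (cases x) auto
  moreover from this have "z = 0 \<or> z = 1 \<or> z = 2" by linarith
  ultimately show ?thesis by auto
qed

lemma F2_simps: "(0::2) \<noteq> 1" "(1::2) + 1 = 0"
  by simp_all

lemma F3_simps: "(0::3) \<noteq> 1" "(0::3) \<noteq> 2" "(1::3) \<noteq> 2" "(1::3) + 1 = 2" "(1::3) + 2 = 0"
    "(2::3) + 1 = 0" "(2::3) + 2 = 1" "- (1::3) = 2" "- (2::3) = 1"
  by simp_all

lemma F2_inverse: "x \<noteq> 0 \<Longrightarrow> \<exists>y. x * y = 1" for x :: 2
  using F2_cases[of x] by auto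

lemma F3_inverse: "x \<noteq> 0 \<Longrightarrow> \<exists>y. x * y = 1" for x :: 3
proof -
  assume "x \<noteq> 0"
  with F3_cases[of x] consider "x = 1" | "x = 2" by auto
  then show ?thesis
  proof cases
    case 2
    have "(2::3) * 2 = 1" by simp
    with 2 show ?thesis by blast
  qed auto
qed

section \<open>The rings\<close>

text \<open>
  What the two rings have in common: six distinct elements \<open>0, a, b, a + b, 2b, a + 2b\<close>,
  \<open>2a = 0\<close>, \<open>3b = 0\<close> and \<open>ab = ba = 0\<close>. There is no unit, so that multiples by
  integers are written as sums.
\<close>

class hring = comm_ring +
  fixes gen_a :: 'a and gen_b :: 'a
  assumes two_a: "gen_a + gen_a = 0"
    and three_b: "gen_b + gen_b + gen_b = 0"
    and ab: "gen_a * gen_b = 0"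
    and ba: "gen_b * gen_a = 0"
    and UNIV_hring: "UNIV = {0, gen_a, gen_b, gen_a + gen_b, gen_b + gen_b, gen_a + (gen_b + gen_b)}"
    and distinct_hring:
      "distinct [0, gen_a, gen_b, gen_a + gen_b, gen_b + gen_b, gen_a + (gen_b + gen_b)]"

text \<open>In both types the constructor applied to \<open>x\<close> and \<open>y\<close> stands for \<open>a x + b y\<close>.\<close>

datatype H23 = H23 2 3
datatype H32 = H32 2 3

instantiation H23 :: hring
begin

fun plus_H23 where "H23 x y + H23 x' y' = H23 (x + x') (y + y')"
fun minus_H23 where "H23 x y - H23 x' y' = H23 (x - x') (y - y')"
fun uminus_H23 where "- H23 x y = H23 (- x) (- y)"
fun times_H23 where "H23 x y * H23 x' y' = H23 (x * x') 0"
definition "0 = H23 0 0"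
definition "gen_a = H23 1 0"
definition "gen_b = H23 0 1"

instance
proof
  show "UNIV = {0::H23, gen_a, gen_b, gen_a + gen_b, gen_b + gen_b, gen_a + (gen_b + gen_b)}"
  proof -
    have "z \<in> {0, gen_a, gen_b, gen_a + gen_b, gen_b + gen_b, gen_a + (gen_b + gen_b)}" for z :: H23
    proof (cases z)
      case (H23 x y)
      then show ?thesis
        using F2_cases[of x] F3_cases[of y]
        by (auto simp: zero_H23_def gen_a_H23_def gen_b_H23_def)
    qed
    then show ?thesis by blast
  qed
next
  fix x y z :: H23
  show "x + y + z = x + (y + z)" by (cases x; cases y; cases z) simp
  show "x + y = y + x" by (cases x; cases y) simp
  show "0 + x = x" by (cases x) (simp add: zero_H23_def)
  show "- x + x = 0" by (cases x) (simp add: zero_H23_def)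
  show "x - y = x + - y" by (cases x; cases y) simp
  show "x * y * z = x * (y * z)" by (cases x; cases y; cases z) (simp add: mult.assoc)
  show "x * y = y * x" by (cases x; cases y) (simp add: mult.commute)
  show "(x + y) * z = x * z + y * z" by (cases x; cases y; cases z) (simp add: distrib_right)
qed (simp_all add: zero_H23_def gen_a_H23_def gen_b_H23_def)

end

instantiation H32 :: hring
begin

fun plus_H32 where "H32 x y + H32 x' y' = H32 (x + x') (y + y')"
fun minus_H32 where "H32 x y - H32 x' y' = H32 (x - x') (y - y')"
fun uminus_H32 where "- H32 x y = H32 (- x) (- y)"
fun times_H32 where "H32 x y * H32 x' y' = H32 0 (y * y')"
definition "0 = H32 0 0"
definition "gen_a = H32 1 0"
definition "gen_b = H32 0 1"

instance
proof
  show "UNIV = {0::H32, gen_a, gen_b, gen_a + gen_b, gen_b + gen_b, gen_a + (gen_b + gen_b)}"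
  proof -
    have "z \<in> {0, gen_a, gen_b, gen_a + gen_b, gen_b + gen_b, gen_a + (gen_b + gen_b)}" for z :: H32
    proof (cases z)
      case (H32 x y)
      then show ?thesis
        using F2_cases[of x] F3_cases[of y]
        by (auto simp: zero_H32_def gen_a_H32_def gen_b_H32_def)
    qed
    then show ?thesis by blast
  qed
next
  fix x y z :: H32
  show "x + y + z = x + (y + z)" by (cases x; cases y; cases z) simp
  show "x + y = y + x" by (cases x; cases y) simp
  show "0 + x = x" by (cases x) (simp add: zero_H32_def)
  show "- x + x = 0" by (cases x) (simp add: zero_H32_def)
  show "x - y = x + - y" by (cases x; cases y) simp
  show "x * y * z = x * (y * z)" by (cases x; cases y; cases z) (simp add: mult.assoc)
  show "x * y = y * x" by (cases x; cases y) (simp add: mult.commute)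
  show "(x + y) * z = x * z + y * z" by (cases x; cases y; cases z) (simp add: distrib_right)
qed (simp_all add: zero_H32_def gen_a_H32_def gen_b_H32_def)

end

text \<open>The relations in which the rings differ.\<close>

lemma H23_relations: "gen_a * gen_a = (gen_a :: H23)" "gen_b * gen_b = (0 :: H23)"
  by (simp_all add: gen_a_H23_def gen_b_H23_def zero_H23_def)

lemma H32_relations: "gen_a * gen_a = (0 :: H32)" "gen_b * gen_b = (gen_b :: H32)"
  by (simp_all add: gen_a_H32_def gen_b_H32_def zero_H32_def)

section \<open>Vectors over the rings\<close>

text \<open>
  \<open>mult2 r x\<close> and \<open>mult3 r y\<close> are the products \<open>r x\<close> and \<open>r y\<close> of a ring element with a scalar
  from the field with two or three elements; they are used for \<open>r\<close> among \<open>a, a\<^sup>2\<close> and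
  \<open>b, b\<^sup>2\<close> respectively.
\<close>

definition mult2 :: "'h::hring \<Rightarrow> 2 \<Rightarrow> 'h" where
  "mult2 r x = (if x = 0 then 0 else r)"

definition mult3 :: "'h::hring \<Rightarrow> 3 \<Rightarrow> 'h" where
  "mult3 r y = (if y = 0 then 0 else if y = 1 then r else r + r)"

definition a_vec :: "2 ^ 'n \<Rightarrow> 'h::hring ^ 'n" where
  "a_vec x = (\<chi> i. mult2 gen_a (x $ i))"

definition b_vec :: "3 ^ 'n \<Rightarrow> 'h::hring ^ 'n" where
  "b_vec y = (\<chi> i. mult3 gen_b (y $ i))"

text \<open>The coordinates \<open>x\<close> and \<open>y\<close> of \<open>c = a x + b y\<close>; existence and uniqueness are proved below.\<close>

definition a_part :: "'h::hring ^ 'n \<Rightarrow> 2 ^ 'n" where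
  "a_part c = (THE x. \<exists>y. c = a_vec x + b_vec y)"

definition b_part :: "'h::hring ^ 'n \<Rightarrow> 3 ^ 'n" where
  "b_part c = (THE y. \<exists>x. c = a_vec x + b_vec y)"

lemma hring_repr: "\<exists>x y. r = mult2 gen_a x + mult3 gen_b y" for r :: "'h::hring"
proof -
  have "r \<in> {0, gen_a, gen_b, gen_a + gen_b, gen_b + gen_b, gen_a + (gen_b + gen_b)}"
    using UNIV_hring by blast
  then have "r = mult2 gen_a 0 + mult3 gen_b 0 \<or> r = mult2 gen_a 1 + mult3 gen_b 0
      \<or> r = mult2 gen_a 0 + mult3 gen_b 1 \<or> r = mult2 gen_a 1 + mult3 gen_b 1
      \<or> r = mult2 gen_a 0 + mult3 gen_b 2 \<or> r = mult2 gen_a 1 + mult3 gen_b 2"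
    by (auto simp: mult2_def mult3_def)
  then show ?thesis by blast
qed

lemma hring_unique:
  assumes "mult2 (gen_a::'h::hring) x + mult3 gen_b y = mult2 gen_a x' + mult3 gen_b y'"
  shows "x = x' \<and> y = y'"
proof -
  let ?f = "\<lambda>(x, y). mult2 gen_a x + mult3 gen_b y :: 'h"
  have "range ?f = UNIV"
    using hring_repr[where 'h='h] by (auto simp: image_def)
  moreover have "card (UNIV :: 'h set) = 6"
    using distinct_card[OF distinct_hring[where 'a='h]] by (simp add: UNIV_hring)
  moreover have "card (UNIV :: (2 \<times> 3) set) = 6"
    by (simp add: card_cartesian_product flip: UNIV_Times_UNIV)
  ultimately have "inj ?f"
    by (intro eq_card_imp_inj_on) simp_all
  from injD[OF this, of "(x, y)" "(x', y')"] assms show ?thesis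
    by simp
qed

lemma vec_repr: "\<exists>x y. c = a_vec x + b_vec y" for c :: "'h::hring ^ 'n"
proof -
  have "\<forall>i. \<exists>x y. c $ i = mult2 gen_a x + mult3 gen_b y"
    using hring_repr by blast
  then obtain f g where "\<And>i. c $ i = mult2 gen_a (f i) + mult3 gen_b (g i)"
    by metis
  then have "c = a_vec (\<chi> i. f i) + b_vec (\<chi> i. g i)"
    by (simp add: vec_eq_iff a_vec_def b_vec_def)
  then show ?thesis by blast
qed

lemma vec_unique:
  assumes "(a_vec x + b_vec y :: 'h::hring ^ 'n) = a_vec x' + b_vec y'"
  shows "x = x' \<and> y = y'"
proof -
  have "x $ i = x' $ i \<and> y $ i = y' $ i" for i
    using arg_cong[OF assms, of "\<lambda>c. c $ i"]
    by (intro hring_unique[where 'h='h]) (simp add: a_vec_def b_vec_def)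
  then show ?thesis by (simp add: vec_eq_iff)
qed

lemma parts_eq:
  "a_part (a_vec x + b_vec y :: 'h::hring ^ 'n) = x"
  "b_part (a_vec x + b_vec y :: 'h::hring ^ 'n) = y"
  unfolding a_part_def b_part_def by (rule the_equality; use vec_unique in blast)+

section \<open>Codes\<close>

definition H_code :: "('h::hring ^ 'n) set \<Rightarrow> bool" where
  "H_code C \<longleftrightarrow> 0 \<in> C \<and> (\<forall>c\<in>C. \<forall>d\<in>C. c + d \<in> C) \<and> (\<forall>c\<in>C. - c \<in> C)
     \<and> (\<forall>r. \<forall>c\<in>C. r *s c \<in> C)"

definition linear_code :: "('f::comm_ring_1 ^ 'n) set \<Rightarrow> bool" where
  "linear_code C \<longleftrightarrow> module.subspace (*s) C"

definition comp_a :: "('h::hring ^ 'n) set \<Rightarrow> (2 ^ 'n) set" where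
  "comp_a C = {u. a_vec u \<in> C}"

definition comp_b :: "('h::hring ^ 'n) set \<Rightarrow> (3 ^ 'n) set" where
  "comp_b C = {v. b_vec v \<in> C}"

lemma a_vec_simps:
  "(a_vec 0 :: 'h::hring ^ 'n) = 0"
  "(a_vec (x + x') :: 'h ^ 'n) = a_vec x + a_vec x'"
proof -
  have "mult2 (gen_a::'h) (s + t) = mult2 gen_a s + mult2 gen_a t" for s t
    using F2_cases[of s] F2_cases[of t] by (auto simp: mult2_def two_a)
  then show "(a_vec (x + x') :: 'h ^ 'n) = a_vec x + a_vec x'"
    by (simp add: vec_eq_iff a_vec_def)
qed (simp add: vec_eq_iff a_vec_def mult2_def)

lemma b_vec_simps:
  "(b_vec 0 :: 'h::hring ^ 'n) = 0"
  "(b_vec (y + y') :: 'h ^ 'n) = b_vec y + b_vec y'"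
proof -
  have "gen_b + (gen_b + gen_b) = (0::'h)" "gen_b + gen_b + (gen_b + gen_b) = (gen_b::'h)"
    using three_b[where 'a='h] by (simp_all add: add.assoc)
  then have "mult3 (gen_b::'h) (s + t) = mult3 gen_b s + mult3 gen_b t" for s t
    using F3_cases[of s] F3_cases[of t] three_b[where 'a='h] by (auto simp: mult3_def)
  then show "(b_vec (y + y') :: 'h ^ 'n) = b_vec y + b_vec y'"
    by (simp add: vec_eq_iff b_vec_def)
qed (simp add: vec_eq_iff b_vec_def mult3_def)

lemma part_in_code:
  assumes "H_code C" "(a_vec u + b_vec v :: 'h::hring ^ 'n) \<in> C"
  shows "a_vec u \<in> C" "b_vec v \<in> C"
proof -
  let ?c = "a_vec u + b_vec v :: 'h ^ 'n"
  have a2: "(a_vec u :: 'h ^ 'n) + a_vec u = 0"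
  proof -
    have "t + t = 0" for t :: 2 using F2_cases[of t] by auto
    then have "u + u = 0" by (simp only: vec_eq_iff vector_add_component zero_index) simp
    then show ?thesis by (simp only: a_vec_simps flip: a_vec_simps(2))
  qed
  have b3: "(b_vec v :: 'h ^ 'n) + b_vec v + b_vec v = 0"
  proof -
    have "t + t + t = 0" for t :: 3 using F3_cases[of t] by auto
    then have "v + v + v = 0" by (simp only: vec_eq_iff vector_add_component zero_index) simp
    then show ?thesis by (simp only: b_vec_simps flip: b_vec_simps(2))
  qed
  have "?c + ?c + ?c \<in> C" using assms by (auto simp: H_code_def)
  also have "?c + ?c + ?c = (a_vec u + a_vec u) + a_vec u + (b_vec v + b_vec v + b_vec v)"
    by (simp add: ac_simps)
  also have "\<dots> = a_vec u" by (simp only: a2 b3) simp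
  finally show a: "a_vec u \<in> C" .
  have "?c + - a_vec u \<in> C" using assms a unfolding H_code_def by blast
  then show "b_vec v \<in> C" by simp
qed

text \<open>The decomposition of a code into its binary and its ternary component.\<close>

lemma H_code_decomp:
  fixes C :: "('h::hring ^ 'n) set"
  assumes "H_code C"
  shows "C = {a_vec u + b_vec v | u v. u \<in> comp_a C \<and> v \<in> comp_b C}"
proof
  show "C \<subseteq> {a_vec u + b_vec v | u v. u \<in> comp_a C \<and> v \<in> comp_b C}"
  proof
    fix c assume "c \<in> C"
    moreover obtain u v where "c = a_vec u + b_vec v" using vec_repr[of c] by blast
    ultimately show "c \<in> {a_vec u + b_vec v | u v. u \<in> comp_a C \<and> v \<in> comp_b C}"
      using part_in_code[OF assms, of u v] by (auto simp: comp_a_def comp_b_def)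
  qed
  show "{a_vec u + b_vec v | u v. u \<in> comp_a C \<and> v \<in> comp_b C} \<subseteq> C"
    using assms by (auto simp: comp_a_def comp_b_def H_code_def)
qed

lemma module_vec: "module ((*s) :: 'f::comm_ring_1 \<Rightarrow> 'f ^ 'n \<Rightarrow> 'f ^ 'n)"
  by unfold_locales (simp_all add: vec_eq_iff vector_scalar_mult_def algebra_simps)

lemma linear_comp_a: "H_code C \<Longrightarrow> linear_code (comp_a C)"
proof -
  assume C: "H_code C"
  have "c *s x \<in> comp_a C" if "x \<in> comp_a C" for c x
  proof -
    have "c *s x = 0 \<or> c *s x = x"
      using F2_cases[of c] by (auto simp: vec_eq_iff vector_scalar_mult_def)
    with that C show ?thesis by (auto simp: comp_a_def H_code_def a_vec_simps)
  qed
  with C show ?thesis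
    unfolding linear_code_def module.subspace_def[OF module_vec]
    by (auto simp: comp_a_def H_code_def a_vec_simps)
qed

lemma linear_comp_b: "H_code C \<Longrightarrow> linear_code (comp_b C)"
proof -
  assume C: "H_code C"
  have "c *s x \<in> comp_b C" if "x \<in> comp_b C" for c x
  proof -
    have "2 * t = t + t" for t :: 3 using F3_cases[of t] by auto
    then have "c *s x = 0 \<or> c *s x = x \<or> c *s x = x + x"
      using F3_cases[of c] by (auto simp: vec_eq_iff vector_scalar_mult_def)
    moreover have "0 \<in> comp_b C" "x + x \<in> comp_b C"
      using that C by (simp_all only: comp_b_def H_code_def b_vec_simps mem_Collect_eq)
    ultimately show ?thesis using that by metis
  qed
  with C show ?thesis
    unfolding linear_code_def module.subspace_def[OF module_vec]
    by (auto simp: comp_b_def H_code_def b_vec_simps)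
qed

section \<open>Symplectic forms and duality\<close>

text \<open>
  Vectors of length \<open>2m\<close> are indexed by the sum type \<open>'m + 'm\<close> with \<open>CARD('m) = m\<close>; the two
  summands index the two halves of \<open>x = (x\<^sub>1 | x\<^sub>2)\<close>.
\<close>

definition half1 :: "'f ^ ('m + 'm) \<Rightarrow> 'f ^ 'm" where
  "half1 x = (\<chi> i. x $ Inl i)"

definition half2 :: "'f ^ ('m + 'm) \<Rightarrow> 'f ^ 'm" where
  "half2 x = (\<chi> i. x $ Inr i)"

definition dot :: "'f::comm_ring_1 ^ 'm \<Rightarrow> 'f ^ 'm \<Rightarrow> 'f" where
  "dot u v = (\<Sum>i\<in>UNIV. u $ i * v $ i)"

definition symp2 :: "2 ^ ('m::finite + 'm) \<Rightarrow> 2 ^ ('m + 'm) \<Rightarrow> 2" where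
  "symp2 x y = dot (half1 x) (half2 y) + dot (half2 x) (half1 y)"

definition symp3 :: "3 ^ ('m::finite + 'm) \<Rightarrow> 3 ^ ('m + 'm) \<Rightarrow> 3" where
  "symp3 x y = dot (half1 x) (half2 y) - dot (half2 x) (half1 y)"

definition sympH :: "'h::hring ^ ('m::finite + 'm) \<Rightarrow> 'h ^ ('m + 'm) \<Rightarrow> 'h" where
  "sympH c d = mult2 (gen_a * gen_a) (symp2 (a_part c) (a_part d))
             + mult3 (gen_b * gen_b) (symp3 (b_part c) (b_part d))"

lemma sympH_H23: "sympH c d = mult2 (gen_a :: H23) (symp2 (a_part c) (a_part d))"
  by (simp add: sympH_def H23_relations mult3_def)

lemma sympH_H32: "sympH c d = mult3 (gen_b :: H32) (symp3 (b_part c) (b_part d))"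
  by (simp add: sympH_def H32_relations mult2_def)

definition dual :: "('v \<Rightarrow> 'v \<Rightarrow> 's::zero) \<Rightarrow> 'v set \<Rightarrow> 'v set" where
  "dual form C = {v. \<forall>c\<in>C. form v c = 0}"

definition self_orthogonal :: "('v \<Rightarrow> 'v \<Rightarrow> 's::zero) \<Rightarrow> 'v set \<Rightarrow> bool" where
  "self_orthogonal form C \<longleftrightarrow> C \<subseteq> dual form C"

end

theory Submission
  imports Defs
begin

text \<open>Over \<open>H23\<close>, a^2 = a and b^2 = 0, so the form of two words is a times the
  binary form of their binary parts. As a is nonzero, it vanishes exactly when that binary form does
  (\<open>mult2_gen_a_eq_0_iff\<close>). Self-orthogonality of \<open>C\<close> thus depends only on
  the set of binary parts of its words (\<open>self_orthogonal_image\<close>), and this set is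
  \<open>comp_a C\<close> because a code contains both summands of each of its words
  (\<open>a_part_image\<close>). Over \<open>H32\<close> the ternary parts take over, by
  \<open>b_part_image\<close> and \<open>mult3_gen_b_eq_0_iff\<close>.\<close>

lemma a_part_image:
  fixes C :: "('h::hring ^ 'n) set"
  assumes "H_code C"
  shows "a_part ` C = comp_a C"
proof
  show "a_part ` C \<subseteq> comp_a C"
  proof clarify
    fix c assume "c \<in> C"
    moreover obtain u v where "c = a_vec u + b_vec v" using vec_repr[of c] by blast
    ultimately show "a_part c \<in> comp_a C"
      \<comment> \<open>Tripling c = au + bv leaves au, since 2a = 0 and 3b = 0; so au lies in
        \<open>C\<close>.\<close>
      using part_in_code(1)[OF assms, of u v] by (simp add: parts_eq comp_a_def)
  qed
  show "comp_a C \<subseteq> a_part ` C"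
  proof
    fix u assume "u \<in> comp_a C"
    then have "a_vec u \<in> C" by (simp add: comp_a_def)
    moreover have "a_part (a_vec u :: 'h ^ 'n) = u"
      using parts_eq(1)[of u 0] by (simp add: b_vec_simps)
    ultimately show "u \<in> a_part ` C" by force
  qed
qed

lemma b_part_image:
  fixes C :: "('h::hring ^ 'n) set"
  assumes "H_code C"
  shows "b_part ` C = comp_b C"
proof
  show "b_part ` C \<subseteq> comp_b C"
  proof clarify
    fix c assume "c \<in> C"
    moreover obtain u v where "c = a_vec u + b_vec v" using vec_repr[of c] by blast
    ultimately show "b_part c \<in> comp_b C"
      using part_in_code(2)[OF assms, of u v] by (simp add: parts_eq comp_b_def)
  qed
  show "comp_b C \<subseteq> b_part ` C"
  proof
    fix v assume "v \<in> comp_b C"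
    then have "b_vec v \<in> C" by (simp add: comp_b_def)
    \<comment> \<open>The preimage of \<open>v\<close> is the word with zero binary part.\<close>
    moreover have "b_part (b_vec v :: 'h ^ 'n) = v"
      using parts_eq(2)[of 0 v] by (simp add: a_vec_simps)
    ultimately show "v \<in> b_part ` C" by force
  qed
qed

lemma mult2_gen_a_eq_0_iff: "mult2 (gen_a :: 'h::hring) x = 0 \<longleftrightarrow> x = 0"
  using distinct_hring[where 'a='h] by (auto simp: mult2_def)

text \<open>Both b and 2b are nonzero, being listed apart from 0 in
  \<open>distinct_hring\<close>.\<close>

lemma mult3_gen_b_eq_0_iff: "mult3 (gen_b :: 'h::hring) y = 0 \<longleftrightarrow> y = 0"
  using distinct_hring[where 'a='h] by (auto simp: mult3_def)

text \<open>Orthogonality of two words is visible on their images, so quantifying over pairs from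
  \<open>C\<close> or from its image is the same; \<open>f\<close> may identify words.\<close>

lemma self_orthogonal_image:
  assumes "\<And>c d. form c d = 0 \<longleftrightarrow> form' (f c) (f d) = 0"
  shows "self_orthogonal form C \<longleftrightarrow> self_orthogonal form' (f ` C)"
  by (auto simp: self_orthogonal_def dual_def assms)

theorem theorem4p5:
  fixes C :: "(H23 ^ ('m::finite + 'm)) set"
    and D :: "(H32 ^ ('m + 'm)) set"
  shows "(H_code C \<longrightarrow>
            (self_orthogonal sympH C \<longleftrightarrow>
              linear_code (comp_a C) \<and> self_orthogonal symp2 (comp_a C)))
       \<and> (H_code D \<longrightarrow>
            (self_orthogonal sympH D \<longleftrightarrow>
              linear_code (comp_b D) \<and> self_orthogonal symp3 (comp_b D)))"
proof (intro conjI impI)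
  assume C: "H_code C"
  have "self_orthogonal sympH C \<longleftrightarrow> self_orthogonal symp2 (a_part ` C)"
    by (rule self_orthogonal_image) (simp add: sympH_H23 mult2_gen_a_eq_0_iff)
  then show "self_orthogonal sympH C \<longleftrightarrow>
      linear_code (comp_a C) \<and> self_orthogonal symp2 (comp_a C)"
    \<comment> \<open>Linearity of the component comes from \<open>C\<close> being a
      submodule.\<close>
    using C by (simp add: a_part_image linear_comp_a)
next
  assume D: "H_code D"
  have "self_orthogonal sympH D \<longleftrightarrow> self_orthogonal symp3 (b_part ` D)"
    by (rule self_orthogonal_image) (simp add: sympH_H32 mult3_gen_b_eq_0_iff)
  then show "self_orthogonal sympH D \<longleftrightarrow>
      linear_code (comp_b D) \<and> self_orthogonal symp3 (comp_b D)"
    using D by (simp add: b_part_image linear_comp_b)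
qed

end
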